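(* Let $k,v$ be integers with $2\le k<v$, $2k\mid v$ and $v/k\ge 4$, and let $w=v/k$. Let $(X,\mathcal{B})$ be a simple resolvable $(v,b,r,k)$-IBD with a fixed resolution, and let $(Y,\mathcal{C})$ be a simple IBD on $Y=\{1,\dots,w\}$ with block size $w/2=v/(2k)$. Then the constructed design $(X,\mathcal{D})$ obtained from these two designs is nontrivial.
   Context: For positive integers $v,b,r,k$ with $2\le k<v$, a $(v,b,r,k)$-incomplete block design (IBD) is a pair $(X,\mathcal{B})$ where $X$ is a set of $v$ points and $\mathcal{B}$ is a multiset of $b$ subsets of $X$ (blocks), each of size $k$, such that every point lies in exactly $r$ blocks. If $k\mid v$, a parallel class is a set of $v/k$ pairwise disjoint blocks; the IBD is resolvable if $\mathcal{B}$ can be partitioned into $r$ parallel classes (a resolution). A design is simple if its multiset of blocks has no repeated block; a design on $v$ points with block size $K$ is trivial if its blocks are exactly all $\binom{v}{K}$ $K$-subsets of the point set, each once. Constructed design: given a resolvable IBD $(X,\mathcal{B})$ with block size $k$ and a resolution into parallel classes $\Pi_1,\dots,\Pi_r$, where $\Pi_i=\{B_i^1,\dots,B_i^w\}$ and $w=v/k$, and given an IBD $(Y,\mathcal{C})$ with $Y=\{1,\dots,w\}$, define for each $i$ and each block $C\in\mathcal{C}$ the set $D_{i,C}=\bigcup_{j\in C}B_i^j$, and let $\mathcal{D}$ be the multiset $\{D_{i,C}: 1\le i\le r,\ C\in\mathcal{C}\}$. The constructed design is $(X,\mathcal{D})$. *)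

theory Defs
  imports "HOL-Library.Multiset" "HOL-Library.Disjoint_Sets"
begin

definition ibd :: "nat \<Rightarrow> nat \<Rightarrow> nat \<Rightarrow> nat \<Rightarrow> 'a set \<Rightarrow> 'a set multiset \<Rightarrow> bool" where
  "ibd v b r k X \<B> \<longleftrightarrow>
     0 < v \<and> 0 < b \<and> 0 < r \<and> 2 \<le> k \<and> k < v \<and>
     finite X \<and> card X = v \<and> size \<B> = b \<and>
     (\<forall>A\<in>#\<B>. A \<subseteq> X \<and> card A = k) \<and>
     (\<forall>x\<in>X. size (filter_mset (\<lambda>A. x \<in> A) \<B>) = r)"

definition simple_design :: "'a set multiset \<Rightarrow> bool" where
  "simple_design \<B> \<longleftrightarrow> (\<forall>A. count \<B> A \<le> 1)"

definition parallel_class :: "nat \<Rightarrow> nat \<Rightarrow> 'a set multiset \<Rightarrow> 'a set set \<Rightarrow> bool" where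
  "parallel_class v k \<B> P \<longleftrightarrow>
     k dvd v \<and> P \<subseteq> set_mset \<B> \<and> card P = v div k \<and> disjoint P"

text \<open>The multiset sum expresses that the classes \<open>\<R> 1, \<dots>, \<R> r\<close> partition the
  multiset \<open>\<B>\<close>, multiplicities included.\<close>

definition resolution ::
    "nat \<Rightarrow> nat \<Rightarrow> nat \<Rightarrow> 'a set multiset \<Rightarrow> (nat \<Rightarrow> 'a set set) \<Rightarrow> bool" where
  "resolution v r k \<B> \<R> \<longleftrightarrow>
     (\<forall>i\<in>{1..r}. parallel_class v k \<B> (\<R> i)) \<and>
     \<B> = (\<Sum>i\<in>{1..r}. mset_set (\<R> i))"

definition resolvable_ibd ::
    "nat \<Rightarrow> nat \<Rightarrow> nat \<Rightarrow> nat \<Rightarrow> 'a set \<Rightarrow> 'a set multiset \<Rightarrow> bool" where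
  "resolvable_ibd v b r k X \<B> \<longleftrightarrow> ibd v b r k X \<B> \<and> (\<exists>\<R>. resolution v r k \<B> \<R>)"

text \<open>\<open>B i j\<close> is the \<open>j\<close>-th block of the \<open>i\<close>-th parallel class.\<close>

definition block_labelling ::
    "nat \<Rightarrow> nat \<Rightarrow> (nat \<Rightarrow> 'a set set) \<Rightarrow> (nat \<Rightarrow> nat \<Rightarrow> 'a set) \<Rightarrow> bool" where
  "block_labelling r w \<R> B \<longleftrightarrow> (\<forall>i\<in>{1..r}. bij_betw (B i) {1..w} (\<R> i))"

definition constructed_blocks ::
    "nat \<Rightarrow> (nat \<Rightarrow> nat \<Rightarrow> 'a set) \<Rightarrow> nat set multiset \<Rightarrow> 'a set multiset" where
  "constructed_blocks r B \<C> = (\<Sum>i\<in>{1..r}. image_mset (\<lambda>C. \<Union>j\<in>C. B i j) \<C>)"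

definition trivial_design :: "'a set \<Rightarrow> 'a set multiset \<Rightarrow> bool" where
  "trivial_design X \<D> \<longleftrightarrow>
     (\<exists>K. (\<forall>A\<in>#\<D>. card A = K) \<and> \<D> = mset_set {A. A \<subseteq> X \<and> card A = K})"

end

theory Submission
  imports Defs Complex_Main
begin

text \<open>
  Put \<open>h = w / 2\<close>. If the constructed design were trivial, it would contain each of the
  \<open>v choose (h k)\<close> subsets of size \<open>h k = v / 2\<close> exactly once, so \<open>r \<cdot> |\<C>| = v choose (h k)\<close>. By
  simplicity \<open>|\<C>| \<le> w choose h\<close> and \<open>r w = |\<B>| \<le> v choose k\<close>, and after absorption these bounds
  give \<open>(v - 1) choose (h k - 1) \<le> ((v - 1) choose (k - 1)) \<cdot> ((w - 1) choose (h - 1))\<close>. This is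
  false: the quotient of the two binomial coefficients with upper index \<open>v - 1\<close> is the product of
  the factors \<open>(2 h k - j) / j > 1\<close> over \<open>k \<le> j < h k\<close>, and the factors with \<open>k\<close> dividing
  \<open>j\<close> already multiply to \<open>(w - 1) choose (h - 1)\<close>.
\<close>

text \<open>The product telescopes: \<open>real (n - j) / real j\<close> is the ratio of
  \<open>(n - 1) choose j\<close> to \<open>(n - 1) choose (j - 1)\<close>.\<close>

lemma choose_eq_choose_times_prod:
  assumes "0 < k" and "k \<le> m" and "m \<le> n"
  shows "real ((n - 1) choose (m - 1)) =
    real ((n - 1) choose (k - 1)) * (\<Prod>j\<in>{k..<m}. real (n - j) / real j)"
  using assms(2,3)
proof (induction m rule: dec_induct)
  case base
  show ?case by simp
next
  case (step m)
  have "0 < m" using assms(1) step.hyps by simp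
  then obtain p where p: "m = Suc p" by (cases m) auto
  obtain q where q: "n = Suc q" using step.prems by (cases n) auto
  \<comment> \<open>Both sides equal \<open>q * ((q - 1) choose p)\<close>, by the two absorption
    identities.\<close>
  have "m * (q choose m) = (q - p) * (q choose p)"
    unfolding p by (metis binomial_absorb_comp binomial_absorption)
  then have "real m * real (q choose m) = real (n - m) * real (q choose p)"
    unfolding p q by (metis diff_Suc_Suc of_nat_mult)
  then have "real (q choose m) = real (q choose p) * (real (n - m) / real m)"
    using \<open>0 < m\<close> by (simp add: field_simps)
  then show ?case
    using step p q by (simp add: prod.atLeastLessThan_Suc)
qed

lemma choose_product_less_central_choose:
  fixes h k :: nat
  assumes h: "2 \<le> h" and k: "2 \<le> k"
  shows "((2 * h * k - 1) choose (k - 1)) * ((2 * h - 1) choose (h - 1)) <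
    (2 * h * k - 1) choose (h * k - 1)"
proof -
  define f where "f j = real (2 * h * k - j) / real j" for j
  define S where "S = (\<lambda>m. m * k) ` {1..<h}"
  have kh: "k \<le> h * k" "h * k \<le> 2 * h * k" using h by auto
  have S: "S \<subseteq> {k..<h * k}" using h k by (auto simp: S_def)
  have gt1: "1 < f j" if "j \<in> {k..<h * k}" for j
  proof -
    have "real j < real (2 * h * k - j)" using that unfolding of_nat_less_iff by auto
    moreover have "0 < real j" using that k by simp
    ultimately show ?thesis unfolding f_def by (simp only: less_divide_eq_1_pos)
  qed
  \<comment> \<open>The index \<open>k + 1\<close> makes the inequality strict: it is no multiple of
    \<open>k\<close>, and it lies below \<open>h * k\<close> because \<open>k + 1 < 2 * k\<close>.
    Its factor exceeds 1 and does not occur in \<open>prod f S\<close>.\<close>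
  have "\<not> k dvd k + 1" using k by (simp only: dvd_add_triv_left_iff nat_dvd_1_iff_1)
  then have "k + 1 \<notin> S" by (auto simp: S_def)
  moreover have "2 * k \<le> h * k" using h by simp
  then have "k + 1 < h * k" using k by linarith
  then have "k + 1 \<in> {k..<h * k}" by simp
  ultimately have mem: "k + 1 \<in> {k..<h * k} - S" by blast
  have "1 < prod f ({k..<h * k} - S)"
    using gt1 mem by (intro less_1_prod2[OF _ mem]) (auto intro: less_imp_le)
  moreover have "0 < prod f S"
    using S gt1 by (intro prod_pos) (metis less_trans subsetD zero_less_one)
  ultimately have "prod f S < prod f {k..<h * k}"
    using prod.subset_diff[OF S, of f] by simp
  \<comment> \<open>At \<open>j = m * k\<close> the common factor \<open>k\<close> cancels, which
    leaves the factors of the same problem with block size 1.\<close>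
  moreover have "prod f S = (\<Prod>m\<in>{1..<h}. real (2 * h - m) / real m)"
  proof -
    have "inj_on (\<lambda>m. m * k) {1..<h}" using k by (auto simp: inj_on_def)
    then have "prod f S = (\<Prod>m\<in>{1..<h}. f (m * k))"
      unfolding S_def by (simp add: prod.reindex)
    also have "\<dots> = (\<Prod>m\<in>{1..<h}. real (2 * h - m) / real m)"
    proof (rule prod.cong[OF refl])
      fix m
      have "2 * h * k - m * k = (2 * h - m) * k" by (simp add: diff_mult_distrib)
      then show "f (m * k) = real (2 * h - m) / real m" using k by (simp add: f_def)
    qed
    finally show ?thesis .
  qed
  \<comment> \<open>With lower end 1 the leading coefficient is
    \<open>(2 * h - 1) choose 0 = 1\<close>, so only the product remains.\<close>
  moreover have "real ((2 * h - 1) choose (h - 1)) = (\<Prod>m\<in>{1..<h}. real (2 * h - m) / real m)"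
    using choose_eq_choose_times_prod[of 1 h "2 * h"] h by simp
  moreover have "real ((2 * h * k - 1) choose (h * k - 1)) =
      real ((2 * h * k - 1) choose (k - 1)) * prod f {k..<h * k}"
    using choose_eq_choose_times_prod[of k "h * k" "2 * h * k"] kh k by (simp add: f_def)
  moreover have "0 < (2 * h * k - 1) choose (k - 1)"
    using kh by (intro zero_less_binomial) linarith
  ultimately have "real ((2 * h * k - 1) choose (k - 1)) * real ((2 * h - 1) choose (h - 1)) <
      real ((2 * h * k - 1) choose (h * k - 1))"
    by simp
  then show ?thesis by (metis of_nat_less_iff of_nat_mult)
qed

text \<open>Absorption with \<open>k\<close> cancelled. Besides bounding \<open>r\<close>, it is
  used with \<open>w = 2\<close>, where it halves a central binomial coefficient.\<close>

lemma choose_mult_block_size: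
  assumes "0 < k" and "0 < w"
  shows "(w * k) choose k = w * ((w * k - 1) choose (k - 1))"
proof -
  have "k * ((w * k) choose k) = k * (w * ((w * k - 1) choose (k - 1)))"
    using times_binomial_minus1_eq[OF assms(1), of "w * k"] by (simp add: ac_simps)
  then show ?thesis using assms by simp
qed

lemma simple_design_size_le:
  assumes "simple_design \<B>" and "finite X" and "\<And>A. A \<in># \<B> \<Longrightarrow> A \<subseteq> X \<and> card A = k"
  shows "size \<B> \<le> card X choose k"
proof -
  have "size \<B> = (\<Sum>A\<in>set_mset \<B>. count \<B> A)" by (simp add: size_multiset_overloaded_eq)
  also have "\<dots> \<le> (\<Sum>A\<in>set_mset \<B>. 1)"
    using assms(1) by (intro sum_mono) (auto simp: simple_design_def)
  also have "\<dots> = card (set_mset \<B>)" by simp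
  also have "\<dots> \<le> card {A. A \<subseteq> X \<and> card A = k}"
    using assms(2,3) by (intro card_mono) auto
  also have "\<dots> = card X choose k" using assms(2) by (rule n_subsets)
  finally show ?thesis .
qed

theorem theorem3p1:
  fixes v b r k w b' r' :: nat
    and X :: "'a set" and \<B> :: "'a set multiset"
    and \<R> :: "nat \<Rightarrow> 'a set set" and B :: "nat \<Rightarrow> nat \<Rightarrow> 'a set"
    and \<C> :: "nat set multiset"
  assumes "2 \<le> k" and "k < v" and "2 * k dvd v" and "v div k \<ge> 4" and "w = v div k"
    and "resolvable_ibd v b r k X \<B>" and "simple_design \<B>"
    and "resolution v r k \<B> \<R>" and "block_labelling r w \<R> B"
    and "ibd w b' r' (w div 2) {1..w} \<C>" and "simple_design \<C>"
  shows "\<not> trivial_design X (constructed_blocks r B \<C>)"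
proof
  assume triv: "trivial_design X (constructed_blocks r B \<C>)"
  obtain h where "v = 2 * k * h" using assms(3) by (auto simp: dvd_def)
  then have v: "v = 2 * h * k" and w: "w = 2 * h"
    using assms(1,5) by simp_all
  then have h: "2 \<le> h" using assms(4,5) by simp
  have X: "finite X" "card X = v" and r: "0 < r"
    and blocks: "\<And>A. A \<in># \<B> \<Longrightarrow> A \<subseteq> X \<and> card A = k"
    using assms(6) by (auto simp: resolvable_ibd_def ibd_def)
  have C: "\<C> \<noteq> {#}" "\<And>C. C \<in># \<C> \<Longrightarrow> C \<subseteq> {1..w} \<and> card C = h"
    using assms(10) w by (auto simp: ibd_def)
  have pc: "\<And>i. i \<in> {1..r} \<Longrightarrow> parallel_class v k \<B> (\<R> i)"
    and sum: "\<B> = (\<Sum>i\<in>{1..r}. mset_set (\<R> i))"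
    using assms(8) by (auto simp: resolution_def)

  have "size \<B> = (\<Sum>i\<in>{1..r}. card (\<R> i))"
    unfolding sum by simp
  also have "\<dots> = r * w" using pc assms(5) by (simp add: parallel_class_def)
  finally have "r * w \<le> v choose k"
    using simple_design_size_le[OF assms(7) X(1) blocks] X(2) by simp
  then have "w * r \<le> w * ((v - 1) choose (k - 1))"
    using choose_mult_block_size[of k w] assms(1) h v w by (simp add: mult.commute)
  then have r_le: "r \<le> (v - 1) choose (k - 1)" using h w by simp
  have C_le: "size \<C> \<le> w choose h"
    using simple_design_size_le[OF assms(11) _ C(2)] by simp

  \<comment> \<open>Triviality only asserts that some common block size exists. Measuring one block,
    taken from the first parallel class, forces that size to be \<open>h * k\<close>.\<close>
  obtain C where CC: "C \<in># \<C>" using C(1) by auto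
  have bij: "bij_betw (B 1) {1..w} (\<R> 1)" using assms(9) r by (simp add: block_labelling_def)
  have pc1: "disjoint (\<R> 1)" "\<R> 1 \<subseteq> set_mset \<B>"
    using pc[of 1] r by (auto simp: parallel_class_def)
  have Csub: "C \<subseteq> {1..w}" and Ccard: "card C = h" using C(2)[OF CC] by auto
  have B1: "B 1 j \<subseteq> X \<and> card (B 1 j) = k" if "j \<in> C" for j
    using that Csub bij pc1(2) blocks by (meson bij_betwE subsetD)
  \<comment> \<open>Distinct labels name distinct blocks by injectivity, and distinct blocks of a
    parallel class are disjoint.\<close>
  have disj: "B 1 i \<inter> B 1 j = {}" if "i \<in> C" "j \<in> C" "i \<noteq> j" for i j
    using that Csub bij pc1(1) unfolding bij_betw_def inj_on_def disjoint_def
    by (metis image_eqI subsetD)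
  have "card (\<Union>j\<in>C. B 1 j) = (\<Sum>j\<in>C. card (B 1 j))"
  proof (rule card_UN_disjoint)
    show "finite C" using Csub finite_subset by blast
    show "\<forall>j\<in>C. finite (B 1 j)" using B1 X(1) finite_subset by blast
    show "\<forall>i\<in>C. \<forall>j\<in>C. i \<noteq> j \<longrightarrow> B 1 i \<inter> B 1 j = {}" using disj by blast
  qed
  also have "\<dots> = h * k" using B1 Ccard by simp
  finally have card_D: "card (\<Union>j\<in>C. B 1 j) = h * k" .
  have "(\<Union>j\<in>C. B 1 j) \<in># constructed_blocks r B \<C>"
    using CC r by (force simp: constructed_blocks_def set_mset_sum)
  then have "constructed_blocks r B \<C> = mset_set {A. A \<subseteq> X \<and> card A = h * k}"
    using triv card_D unfolding trivial_design_def by metis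
  then have "size (constructed_blocks r B \<C>) = v choose (h * k)"
    using n_subsets[OF X(1)] X(2) by simp
  \<comment> \<open>Blocks count with multiplicity here, so coincidences between the unions do not
    matter.\<close>
  moreover have "size (constructed_blocks r B \<C>) = r * size \<C>"
    by (simp add: constructed_blocks_def)
  ultimately have "v choose (h * k) \<le> ((v - 1) choose (k - 1)) * (w choose h)"
    using mult_le_mono[OF r_le C_le] by simp
  \<comment> \<open>This factor 2 and the one from \<open>w choose h\<close> cancel, which leaves
    the inequality already refuted.\<close>
  moreover have "v choose (h * k) = 2 * ((v - 1) choose (h * k - 1))"
    using choose_mult_block_size[of "h * k" 2] assms(1) h v by (simp add: mult.assoc)
  moreover have "w choose h = 2 * ((w - 1) choose (h - 1))"
    using choose_mult_block_size[of h 2] h w by simp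
  ultimately show False
    using choose_product_less_central_choose[OF h assms(1)] v w by simp
qed

end
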